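(* Let $Z$ be a real-valued random variable and put $\sigma:=\sigma_{\max}(Z)\in[0,\infty)$ (this supremum is always finite). Then there exist a Gaussian-free random variable $Y$ and a random variable $G\sim\mathcal{N}(0,\sigma^2)$, independent of $Y$, such that $$Z\stackrel{d}{=}Y+G.$$ The decomposition is maximal and unique up to a translation: if $Z\stackrel{d}{=}Y'+G'$ with $Y'$ and $G'$ independent, $Y'$ Gaussian-free and $G'\sim\mathcal{N}(m,\tau^2)$, then $\tau=\sigma$ and $Y'\stackrel{d}{=}Y-m$.
   Context: $\stackrel{d}{=}$ means equality in law; $\varphi_Z(t)=\mathbb{E}[e^{itZ}]$. $\mathcal{N}(\mu,0)=\delta_\mu$, so constants count as (degenerate) Gaussian; standard deviations $\sigma,\tau$ are taken $\ge 0$. A real-valued random variable $Z$ is Gaussian-free if for every decomposition $Z\stackrel{d}{=}U_1+U_2$ with $U_1,U_2$ independent, neither $U_1$ nor $U_2$ is a non-degenerate Gaussian random variable; equivalently, the law of $Z$ has no non-degenerate Gaussian convolution factor. For a real-valued random variable $Z$, let $S(Z)$ be the set of all $s\in[0,\infty)$ for which the function $t\mapsto\varphi_Z(t)\exp(\tfrac12s^2t^2)$ on $\mathbb{R}$ is the characteristic function of a probability measure on $\mathbb{R}$, and put $\sigma_{\max}(Z):=\sup S(Z)\in[0,\infty]$. *)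

theory Defs
  imports "HOL-Probability.Probability"
begin

text \<open>
  The normal law with mean \<open>\<mu>\<close> and standard deviation \<open>\<sigma> \<ge> 0\<close>, i.e. \<open>N(\<mu>, \<sigma>\<^sup>2)\<close>.  The second
  parameter is the standard deviation, as for \<^const>\<open>normal_density\<close>.  The case \<open>\<sigma> = 0\<close> must be
  treated separately, since \<open>normal_density \<mu> 0\<close> is the zero function.
\<close>

definition normal_law :: "real \<Rightarrow> real \<Rightarrow> real measure" where
  "normal_law \<mu> \<sigma> =
     (if \<sigma> = 0 then return borel \<mu> else density lborel (\<lambda>x. ennreal (normal_density \<mu> \<sigma> x)))"

definition nondegenerate_gaussian :: "real measure \<Rightarrow> bool" where
  "nondegenerate_gaussian P \<longleftrightarrow> (\<exists>\<mu> \<sigma>. \<sigma> > 0 \<and> P = normal_law \<mu> \<sigma>)"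

text \<open>
  The definition ranges over all decompositions of the law of \<open>Z\<close> as a sum \<open>U\<^sub>1 + U\<^sub>2\<close>
  of independent random variables.  A definition cannot quantify over the type of the underlying
  sample space, so the sample space is taken in \<open>real \<times> real\<close>.  No generality is lost, because
  \<open>(U\<^sub>1, U\<^sub>2)\<close> can be replaced by the coordinate projections under its joint law: see
  \<open>gaussian_freeD\<close> below.
\<close>

definition gaussian_free :: "'a measure \<Rightarrow> ('a \<Rightarrow> real) \<Rightarrow> bool" where
  "gaussian_free M Z \<longleftrightarrow>
     (\<forall>(N :: (real \<times> real) measure) U\<^sub>1 U\<^sub>2.
        prob_space N \<longrightarrow>
        prob_space.indep_var N borel U\<^sub>1 borel U\<^sub>2 \<longrightarrow>
        distr M borel Z = distr N borel (\<lambda>\<omega>. U\<^sub>1 \<omega> + U\<^sub>2 \<omega>) \<longrightarrow>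
        \<not> nondegenerate_gaussian (distr N borel U\<^sub>1) \<and>
        \<not> nondegenerate_gaussian (distr N borel U\<^sub>2))"

lemma gaussian_freeD:
  fixes N :: "'b measure"
  assumes free: "gaussian_free M Z"
    and N: "prob_space N"
    and indep: "prob_space.indep_var N borel U\<^sub>1 borel U\<^sub>2"
    and Z: "distr M borel Z = distr N borel (\<lambda>\<omega>. U\<^sub>1 \<omega> + U\<^sub>2 \<omega>)"
  shows "\<not> nondegenerate_gaussian (distr N borel U\<^sub>1) \<and>
         \<not> nondegenerate_gaussian (distr N borel U\<^sub>2)"
proof -
  interpret N: prob_space N by fact
  have [measurable]: "U\<^sub>1 \<in> borel_measurable N" "U\<^sub>2 \<in> borel_measurable N"
    using indep by (auto dest: N.indep_var_rv1 N.indep_var_rv2)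
  define P where "P = distr N (borel \<Otimes>\<^sub>M borel) (\<lambda>\<omega>. (U\<^sub>1 \<omega>, U\<^sub>2 \<omega>))"
  interpret P: prob_space P unfolding P_def by (rule N.prob_space_distr) simp
  have P_sets[measurable_cong]: "sets P = sets (borel \<Otimes>\<^sub>M borel)" by (simp add: P_def)
  have fst: "distr P borel fst = distr N borel U\<^sub>1"
    unfolding P_def by (subst distr_distr) (auto simp: comp_def)
  have snd: "distr P borel snd = distr N borel U\<^sub>2"
    unfolding P_def by (subst distr_distr) (auto simp: comp_def)
  have P_prod: "P = distr N borel U\<^sub>1 \<Otimes>\<^sub>M distr N borel U\<^sub>2"
    using indep by (simp add: N.indep_var_distribution_eq P_def)
  have "P.indep_var borel fst borel snd"
    unfolding P.indep_var_distribution_eq fst snd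
    by (auto simp: P_prod[symmetric] P_sets distr_id2)
  moreover have "distr M borel Z = distr P borel (\<lambda>\<omega>. fst \<omega> + snd \<omega>)"
    unfolding Z P_def by (subst distr_distr) (auto simp: comp_def)
  ultimately show ?thesis
    using free P.prob_space_axioms unfolding gaussian_free_def by (metis fst snd)
qed

definition gaussian_scales :: "'a measure \<Rightarrow> ('a \<Rightarrow> real) \<Rightarrow> real set" where
  "gaussian_scales M Z =
     {s. 0 \<le> s \<and>
         (\<exists>P. real_distribution P \<and>
              (\<forall>t. char P t = char (distr M borel Z) t * complex_of_real (exp (1 / 2 * s\<^sup>2 * t\<^sup>2))))}"

definition sigma_max :: "'a measure \<Rightarrow> ('a \<Rightarrow> real) \<Rightarrow> ereal" where
  "sigma_max M Z = Sup (ereal ` gaussian_scales M Z)"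

end

theory Submission
  imports Defs
begin

text \<open>
  Write \<open>\<phi>\<close> for the characteristic function of \<open>Z\<close>.  Since the law of a sum of independent
  variables has the product of their characteristic functions, and since a law is determined by its
  characteristic function, \<open>s\<close> lies in \<open>gaussian_scales M Z\<close> exactly if \<open>N(0, s\<^sup>2)\<close> is a convolution
  factor of the law of \<open>Z\<close>.  In particular \<open>Z\<close> is Gaussian-free if and only if no positive \<open>s\<close> is a
  Gaussian scale of \<open>Z\<close> (\<open>gaussian_free_iff_scales\<close>).  All of the theorem thus becomes a statement
  about this set of scales.

  The one analytic point is that the supremum \<open>\<sigma>\<close> is finite and attained
  (\<open>gaussian_scales_attain_sup\<close>).  It is finite because \<open>\<bar>\<phi> t\<bar> exp (s\<^sup>2 t\<^sup>2 / 2) \<le> 1\<close> for every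
  scale \<open>s\<close>, where \<open>t \<noteq> 0\<close> can be fixed with \<open>\<phi> t \<noteq> 0\<close>.  It is attained because the set of scales is
  closed (\<open>closed_gaussian_scales\<close>): if \<open>s\<^sub>n \<rightarrow> l\<close> are scales and \<open>P\<^sub>n\<close> are the complementary factors,
  then a weak limit point of the \<open>P\<^sub>n\<close> is the complementary factor for \<open>l\<close>.  Such a limit point
  exists by Helly's theorem, since the \<open>P\<^sub>n\<close> are tight: adding noise with median 0 keeps a variable
  beyond a level with probability at least one half, so \<open>P\<^sub>n\<close> has at most twice the tails of \<open>Z\<close>
  (\<open>tight_if_add_median_zero_noise\<close>).

  Given this, let \<open>Y\<close> have the complementary law \<open>P\<close> for the maximal scale \<open>\<sigma>\<close>.  A scale \<open>s > 0\<close>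
  of \<open>Y\<close> would make \<open>sqrt (\<sigma>\<^sup>2 + s\<^sup>2) > \<sigma>\<close> a scale of \<open>Z\<close>, so \<open>Y\<close> is Gaussian-free.  Conversely, in
  any decomposition \<open>Y' + G'\<close> with \<open>G'\<close> of law \<open>N(m, \<tau>\<^sup>2)\<close>, the number \<open>\<tau>\<close> is a scale of \<open>Z\<close>,
  hence \<open>\<tau> \<le> \<sigma>\<close>; and dividing the two expressions for \<open>\<phi>\<close> shows that \<open>sqrt (\<sigma>\<^sup>2 - \<tau>\<^sup>2)\<close> is a scale
  of \<open>Y'\<close>, with complementary law that of \<open>Y - m\<close>.  As \<open>Y'\<close> is Gaussian-free, \<open>\<tau> = \<sigma>\<close>, and then
  \<open>Y'\<close> and \<open>Y - m\<close> have the same law.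
\<close>

section \<open>Normal laws\<close>

text \<open>
  Realising every normal law, the degenerate one included, as an affine image of the standard one
  makes the case distinction in \<^const>\<open>normal_law\<close> disappear from all later arguments.
\<close>

lemma normal_law_affine:
  assumes "0 \<le> \<sigma>"
  shows "normal_law \<mu> \<sigma> = distr std_normal_distribution borel (\<lambda>x. \<mu> + \<sigma> * x)"
proof -
  interpret S: real_distribution std_normal_distribution by (rule real_dist_normal_dist)
  show ?thesis
  proof (cases "\<sigma> = 0")
    case True
    then show ?thesis
      by (simp add: normal_law_def)
  next
    case False
    with assms have "0 < \<sigma>" by simp
    have "distributed std_normal_distribution lborel (\<lambda>x. x) (\<lambda>x. ennreal (std_normal_density x))"
      by (simp add: distributed_def distr_id2)
    then have "distributed std_normal_distribution lborel (\<lambda>x. \<mu> + \<sigma> * x)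
        (\<lambda>x. ennreal (normal_density (\<mu> + \<sigma> * 0) (\<bar>\<sigma>\<bar> * 1) x))"
      using \<open>0 < \<sigma>\<close> by (intro S.normal_density_affine) auto
    then have "distr std_normal_distribution lborel (\<lambda>x. \<mu> + \<sigma> * x)
        = density lborel (\<lambda>x. ennreal (normal_density \<mu> \<sigma> x))"
      using \<open>0 < \<sigma>\<close> by (simp add: distributed_def)
    moreover have "distr std_normal_distribution lborel (\<lambda>x. \<mu> + \<sigma> * x)
        = distr std_normal_distribution borel (\<lambda>x. \<mu> + \<sigma> * x)"
      by (rule distr_cong) auto
    ultimately show ?thesis using False by (simp add: normal_law_def)
  qed
qed

lemma real_distribution_distr_borel:
  assumes "real_distribution P" "f \<in> borel_measurable borel"
  shows "real_distribution (distr P borel f)"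
proof -
  interpret P: real_distribution P by fact
  show ?thesis using assms(2) by (intro P.real_distribution_distr) auto
qed

lemma real_distribution_normal_law:
  "0 \<le> \<sigma> \<Longrightarrow> real_distribution (normal_law \<mu> \<sigma>)"
  by (simp add: normal_law_affine real_distribution_distr_borel real_dist_normal_dist)

lemma char_distr_affine:
  assumes "real_distribution P"
  shows "char (distr P borel (\<lambda>x. a + b * x)) t = iexp (t * a) * char P (t * b)"
proof -
  interpret P: real_distribution P by fact
  have "char (distr P borel (\<lambda>x. a + b * x)) t = (CLINT x|P. iexp (t * a) * iexp (t * b * x))"
    by (simp add: char_def integral_distr exp_add[symmetric] algebra_simps)
  then show ?thesis by (simp add: char_def)
qed

lemma char_normal_law:
  assumes "0 \<le> \<sigma>"
  shows "char (normal_law \<mu> \<sigma>) t = iexp (t * \<mu>) * complex_of_real (exp (- (1 / 2 * \<sigma>\<^sup>2 * t\<^sup>2)))"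
  unfolding normal_law_affine[OF assms] char_distr_affine[OF real_dist_normal_dist]
    char_std_normal_distribution
  by (simp add: power_mult_distrib mult.commute)

text \<open>
  By symmetry both half-lines have the same mass, and together they cover the line; the common point
  \<open>0\<close> is why only an inequality holds (for \<open>\<sigma> = 0\<close> both masses are 1).
\<close>

lemma normal_law_half_lines:
  assumes "0 \<le> \<sigma>"
  shows "1 / 2 \<le> measure (normal_law 0 \<sigma>) {0..}" "1 / 2 \<le> measure (normal_law 0 \<sigma>) {..0}"
proof -
  let ?Q = "normal_law 0 \<sigma>"
  interpret Q: real_distribution ?Q using assms by (rule real_distribution_normal_law)
  have "distr ?Q borel (\<lambda>x. 0 + (- 1) * x) = ?Q"
  proof (rule Levy_uniqueness)
    show "char (distr ?Q borel (\<lambda>x. 0 + (- 1) * x)) = char ?Q"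
      unfolding fun_eq_iff char_distr_affine[OF Q.real_distribution_axioms] char_normal_law[OF assms]
      by simp
  qed (auto intro!: real_distribution_distr_borel Q.real_distribution_axioms)
  then have "measure ?Q {0..} = measure (distr ?Q borel (\<lambda>x. - x)) {0..}" by simp
  also have "\<dots> = measure ?Q {..0}"
    by (subst measure_distr) (auto simp: vimage_def atMost_def)
  finally have sym: "measure ?Q {0..} = measure ?Q {..0}" .
  have "{0..} \<union> {..0} = (UNIV :: real set)" by auto
  then have "1 = measure ?Q ({0..} \<union> {..0})"
    using Q.prob_space by simp
  also have "\<dots> \<le> measure ?Q {0..} + measure ?Q {..0}"
    by (rule measure_Un_le) auto
  finally show "1 / 2 \<le> measure ?Q {0..}" "1 / 2 \<le> measure ?Q {..0}" using sym by auto
qed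

section \<open>Independent sums realised on the product space\<close>

text \<open>
  Any two laws on the line are the laws of independent variables; here the coordinates of the
  product space serve as these variables.
\<close>

lemma indep_var_pair_measure:
  assumes "real_distribution P" "real_distribution Q"
  shows "prob_space (P \<Otimes>\<^sub>M Q)"
    and "distr (P \<Otimes>\<^sub>M Q) borel fst = P"
    and "distr (P \<Otimes>\<^sub>M Q) borel snd = Q"
    and "prob_space.indep_var (P \<Otimes>\<^sub>M Q) borel fst borel snd"
proof -
  interpret P: real_distribution P by fact
  interpret Q: real_distribution Q by fact
  interpret PQ: pair_prob_space P Q ..
  show "prob_space (P \<Otimes>\<^sub>M Q)" by (rule PQ.prob_space_axioms)
  show f: "distr (P \<Otimes>\<^sub>M Q) borel fst = P"
    using Q.distr_pair_fst[of P] by (simp cong: distr_cong)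
  have "distr (P \<Otimes>\<^sub>M Q) borel snd = distr (distr (Q \<Otimes>\<^sub>M P) (P \<Otimes>\<^sub>M Q) (\<lambda>(x, y). (y, x))) borel snd"
    by (subst PQ.distr_pair_swap) simp
  also have "\<dots> = distr (Q \<Otimes>\<^sub>M P) borel fst"
    by (subst distr_distr) (auto simp: comp_def split_beta)
  also have "\<dots> = Q"
    using P.distr_pair_fst[of Q] by (simp cong: distr_cong)
  finally show s: "distr (P \<Otimes>\<^sub>M Q) borel snd = Q" .
  have "distr (P \<Otimes>\<^sub>M Q) (borel \<Otimes>\<^sub>M borel) (\<lambda>x. x) = P \<Otimes>\<^sub>M Q"
    by (intro distr_id2 sets_pair_measure_cong) auto
  then show "prob_space.indep_var (P \<Otimes>\<^sub>M Q) borel fst borel snd"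
    unfolding PQ.indep_var_distribution_eq f s by auto
qed

lemma char_pair_measure_add:
  assumes "real_distribution P" "real_distribution Q"
  shows "char (distr (P \<Otimes>\<^sub>M Q) borel (\<lambda>\<omega>. fst \<omega> + snd \<omega>)) t = char P t * char Q t"
  using prob_space.char_distr_add[OF indep_var_pair_measure(1,4)[OF assms], of t]
  by (simp add: indep_var_pair_measure[OF assms])

lemma real_distribution_pair_measure_add:
  assumes "real_distribution P" "real_distribution Q"
  shows "real_distribution (distr (P \<Otimes>\<^sub>M Q) borel (\<lambda>\<omega>. fst \<omega> + snd \<omega>))"
proof -
  interpret P: real_distribution P by fact
  interpret Q: real_distribution Q by fact
  interpret PQ: prob_space "P \<Otimes>\<^sub>M Q" by (rule indep_var_pair_measure[OF assms])
  show ?thesis by (rule PQ.real_distribution_distr) simp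
qed

section \<open>The set of Gaussian scales\<close>

text \<open>
  A nondegenerate Gaussian summand \<open>N(\<mu>, s\<^sup>2)\<close> can be centred by moving \<open>\<mu>\<close> into the other summand, so
  its presence only says that dividing \<open>exp (- s\<^sup>2 t\<^sup>2 / 2)\<close> out of the characteristic function leaves a
  characteristic function.
\<close>

lemma gaussian_free_iff_scales:
  assumes "prob_space M" and "Z \<in> borel_measurable M"
  shows "gaussian_free M Z \<longleftrightarrow> (\<forall>s>0. s \<notin> gaussian_scales M Z)"
proof
  interpret prob_space M by fact
  assume free: "gaussian_free M Z"
  show "\<forall>s>0. s \<notin> gaussian_scales M Z"
  proof (intro allI impI notI)
    fix s :: real assume "0 < s" "s \<in> gaussian_scales M Z"
    then obtain P where P: "real_distribution P"
      "\<And>t. char P t = char (distr M borel Z) t * complex_of_real (exp (1 / 2 * s\<^sup>2 * t\<^sup>2))"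
      by (auto simp: gaussian_scales_def)
    let ?Q = "normal_law 0 s"
    have Q: "real_distribution ?Q" using \<open>0 < s\<close> by (intro real_distribution_normal_law) simp
    have "distr M borel Z = distr (P \<Otimes>\<^sub>M ?Q) borel (\<lambda>\<omega>. fst \<omega> + snd \<omega>)"
    proof (rule Levy_uniqueness)
      show "char (distr M borel Z) = char (distr (P \<Otimes>\<^sub>M ?Q) borel (\<lambda>\<omega>. fst \<omega> + snd \<omega>))"
        using \<open>0 < s\<close>
        by (simp add: fun_eq_iff char_pair_measure_add P Q char_normal_law mult.assoc
            flip: of_real_mult exp_add)
    qed (auto intro: real_distribution_pair_measure_add P Q assms)
    then have "\<not> nondegenerate_gaussian (distr (P \<Otimes>\<^sub>M ?Q) borel snd)"
      using gaussian_freeD[OF free indep_var_pair_measure(1,4)[OF P(1) Q]] by blast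
    then show False
      using \<open>0 < s\<close> by (auto simp: indep_var_pair_measure[OF P(1) Q] nondegenerate_gaussian_def)
  qed
next
  assume none: "\<forall>s>0. s \<notin> gaussian_scales M Z"
  have no_factor: "\<not> nondegenerate_gaussian Q"
    if V: "real_distribution V" and char_Z: "\<And>t. char (distr M borel Z) t = char V t * char Q t"
    for V Q
  proof
    assume "nondegenerate_gaussian Q"
    then obtain \<mu> s where s: "0 < s" "Q = normal_law \<mu> s"
      by (auto simp: nondegenerate_gaussian_def)
    let ?P = "distr V borel (\<lambda>x. \<mu> + 1 * x)"
    have "char ?P t = char (distr M borel Z) t * complex_of_real (exp (1 / 2 * s\<^sup>2 * t\<^sup>2))" for t
      unfolding char_distr_affine[OF V] char_Z s(2)
      using s(1) by (simp add: char_normal_law mult.assoc flip: of_real_mult exp_add)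
    then have "s \<in> gaussian_scales M Z"
      unfolding gaussian_scales_def using s(1) V
      by (auto intro!: exI[of _ ?P] real_distribution_distr_borel)
    with none s(1) show False by auto
  qed
  show "gaussian_free M Z"
    unfolding gaussian_free_def
  proof (intro allI impI)
    fix N :: "(real \<times> real) measure" and U V
    assume N: "prob_space N" and UV: "prob_space.indep_var N borel U borel V"
      and Z: "distr M borel Z = distr N borel (\<lambda>\<omega>. U \<omega> + V \<omega>)"
    interpret N: prob_space N by fact
    have "real_distribution (distr N borel U)" "real_distribution (distr N borel V)"
      using UV by (auto dest: N.indep_var_rv1 N.indep_var_rv2)
    then show "\<not> nondegenerate_gaussian (distr N borel U) \<and> \<not> nondegenerate_gaussian (distr N borel V)"
      using no_factor[of "distr N borel U" "distr N borel V"]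
        no_factor[of "distr N borel V" "distr N borel U"]
      by (simp add: Z N.char_distr_add[OF UV] mult.commute)
  qed
qed

lemma zero_in_gaussian_scales:
  assumes "prob_space M" and "Z \<in> borel_measurable M"
  shows "0 \<in> gaussian_scales M Z"
  using prob_space.real_distribution_distr[OF assms] by (auto simp: gaussian_scales_def)

text \<open>
  A characteristic function has modulus at most 1, so at any point \<open>t \<noteq> 0\<close> with \<open>\<phi> t \<noteq> 0\<close> the factor
  \<open>exp (s\<^sup>2 t\<^sup>2 / 2)\<close> cannot exceed \<open>1 / \<bar>\<phi> t\<bar>\<close>.  Such a point exists by continuity at \<open>0\<close>.
\<close>

lemma bdd_above_gaussian_scales:
  assumes "prob_space M" and "Z \<in> borel_measurable M"
  shows "bdd_above (gaussian_scales M Z)"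
proof -
  let ?\<phi> = "char (distr M borel Z)"
  interpret L: real_distribution "distr M borel Z"
    using prob_space.real_distribution_distr[OF assms] .
  have "(?\<phi> \<longlongrightarrow> ?\<phi> 0) (at_right 0)"
    using L.isCont_char[of 0] by (auto simp: isCont_def intro: tendsto_within_subset)
  then have "eventually (\<lambda>t. ?\<phi> t \<noteq> 0) (at_right 0)"
    by (rule tendsto_imp_eventually_ne) (simp add: L.char_zero)
  then have "eventually (\<lambda>t. ?\<phi> t \<noteq> 0 \<and> 0 < t) (at_right 0)"
    by (intro eventually_conj eventually_at_right_less)
  then obtain t where t: "?\<phi> t \<noteq> 0" "0 < t"
    using eventually_happens'[OF trivial_limit_at_right_real] by blast
  show ?thesis
  proof (rule bdd_aboveI)
    fix s assume "s \<in> gaussian_scales M Z"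
    then obtain P where P: "0 \<le> s" "real_distribution P"
      "\<And>t. char P t = ?\<phi> t * complex_of_real (exp (1 / 2 * s\<^sup>2 * t\<^sup>2))"
      by (auto simp: gaussian_scales_def)
    \<comment> \<open>The linear bound \<open>x \<le> exp x\<close> suffices and avoids logarithms.\<close>
    have "norm (?\<phi> t) * (1 / 2 * s\<^sup>2 * t\<^sup>2) \<le> norm (?\<phi> t) * exp (1 / 2 * s\<^sup>2 * t\<^sup>2)"
      using exp_ge_add_one_self[of "1 / 2 * s\<^sup>2 * t\<^sup>2"] by (intro mult_left_mono) (linarith | simp)+
    also have "\<dots> = norm (char P t)"
      unfolding P(3) by (simp add: norm_mult)
    also have "\<dots> \<le> 1" using P(2) by (rule real_distribution.cmod_char_le_1)
    finally have "s\<^sup>2 \<le> 2 / (norm (?\<phi> t) * t\<^sup>2)"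
      using t by (simp add: field_simps)
    then show "s \<le> sqrt (2 / (norm (?\<phi> t) * t\<^sup>2))" by (rule real_le_rsqrt)
  qed
qed

text \<open>
  If \<open>X\<close> and \<open>W\<close> are independent with \<open>Prob(W \<ge> 0) \<ge> 1/2\<close>, then
  \<open>Prob(X \<ge> b) / 2 \<le> Prob(X \<ge> b, W \<ge> 0) \<le> Prob(X + W \<ge> b)\<close>, and likewise for the left tail.  The
  tails of the \<open>P n\<close> are therefore bounded uniformly by twice those of the single law \<open>L\<close>.  The two
  mass conditions say that \<open>0\<close> is a median of the noise.
\<close>

lemma tight_if_add_median_zero_noise:
  fixes P Q :: "nat \<Rightarrow> real measure" and L :: "real measure"
  assumes P: "\<And>n. real_distribution (P n)" and Q: "\<And>n. real_distribution (Q n)"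
    and L: "\<And>n. distr (P n \<Otimes>\<^sub>M Q n) borel (\<lambda>\<omega>. fst \<omega> + snd \<omega>) = L"
    and half: "\<And>n. 1 / 2 \<le> measure (Q n) {0..}" "\<And>n. 1 / 2 \<le> measure (Q n) {..0}"
  shows "tight P"
  unfolding tight_def
proof (intro conjI allI impI P)
  fix \<epsilon> :: real assume "0 < \<epsilon>"
  interpret L: real_distribution L
    using real_distribution_pair_measure_add[OF P[of 0] Q[of 0]] unfolding L .
  have "(\<lambda>n. measure L {- real n <..< real n}) \<longlonglongrightarrow> measure L (\<Union>n. {- real n <..< real n})"
    by (rule L.finite_Lim_measure_incseq) (auto simp: incseq_def)
  also have "(\<Union>n. {- real n <..< real n}) = UNIV"
  proof safe
    fix x :: real
    obtain n where "\<bar>x\<bar> < real n" using reals_Archimedean2 by blast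
    then show "x \<in> (\<Union>n. {- real n <..< real n})" by (auto intro!: exI[of _ n])
  qed auto
  also have "measure L UNIV = 1" using L.prob_space by simp
  finally have "eventually (\<lambda>n. 1 - \<epsilon> / 2 < measure L {- real n <..< real n} \<and> 0 < n) sequentially"
    using \<open>0 < \<epsilon>\<close> by (intro eventually_conj order_tendstoD(1)[where y=1] eventually_gt_at_top) auto
  then obtain m where m: "1 - \<epsilon> / 2 < measure L {- real m <..< real m}" "0 < m"
    using eventually_happens'[OF sequentially_bot] by blast
  define b where "b = real m"
  have b: "1 - \<epsilon> / 2 < measure L {-b<..<b}" "0 < b" using m by (auto simp: b_def)
  have "1 - \<epsilon> < measure (P n) {-b<..b}" for n
  proof -
    interpret P: real_distribution "P n" by (rule P)
    interpret Q: real_distribution "Q n" by (rule Q)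
    interpret PQ: pair_prob_space "P n" "Q n" ..
    \<comment> \<open>Used with \<open>B\<close> a half-line at \<open>0\<close>, and \<open>A = C\<close> a half-line stable under adding elements of \<open>B\<close>.\<close>
    have add: "measure (P n) A * (1 / 2) \<le> measure L C"
      if [measurable]: "A \<in> sets borel" "B \<in> sets borel" "C \<in> sets borel"
        and B: "1 / 2 \<le> measure (Q n) B" and ABC: "\<And>x y. x \<in> A \<Longrightarrow> y \<in> B \<Longrightarrow> x + y \<in> C"
      for A B C
    proof -
      have "measure (P n) A * (1 / 2) \<le> measure (P n) A * measure (Q n) B"
        using B by (intro mult_left_mono) auto
      also have "\<dots> = measure (P n \<Otimes>\<^sub>M Q n) (A \<times> B)"
        by (simp add: measure_def Q.emeasure_pair_measure_Times enn2real_mult)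
      also have "\<dots> \<le> measure (P n \<Otimes>\<^sub>M Q n) ((\<lambda>\<omega>. fst \<omega> + snd \<omega>) -` C \<inter> space (P n \<Otimes>\<^sub>M Q n))"
        using ABC by (intro PQ.finite_measure_mono measurable_sets[where A=borel]) (auto simp: space_pair_measure)
      also have "\<dots> = measure L C"
        unfolding L[of n, symmetric] by (subst measure_distr) auto
      finally show ?thesis .
    qed
    have "measure (P n) {b..} * (1 / 2) \<le> measure L {b..}"
      by (rule add[OF _ _ _ half(1)]) auto
    moreover have "measure (P n) {..-b} * (1 / 2) \<le> measure L {..-b}"
      by (rule add[OF _ _ _ half(2)]) auto
    moreover have split: "measure R {..-b} + measure R {-b<..<b} + measure R {b..} = 1"
      if "real_distribution R" for R
    proof -
      interpret R: real_distribution R by fact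
      have "measure R {..-b} + measure R {-b<..<b} + measure R {b..}
          = measure R ({..-b} \<union> {-b<..<b} \<union> {b..})"
        using b(2) by (subst R.finite_measure_Union; (subst R.finite_measure_Union)?) auto
      also have "{..-b} \<union> {-b<..<b} \<union> {b..} = UNIV" by auto
      finally show ?thesis using R.prob_space by simp
    qed
    ultimately have "1 - \<epsilon> < measure (P n) {-b<..<b}"
      using split[OF L.real_distribution_axioms] split[OF P.real_distribution_axioms] b(1) by argo
    also have "\<dots> \<le> measure (P n) {-b<..b}" by (rule P.finite_measure_mono) auto
    finally show ?thesis .
  qed
  then show "\<exists>a b. a < b \<and> (\<forall>n. 1 - \<epsilon> < measure (P n) {a<..b})"
    using b(2) by (intro exI[of _ "-b"] exI[of _ b]) auto
qed

text \<open>
  The pointwise limit of the characteristic functions of the complementary factors is known; what has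
  to be shown is that it belongs to a law.  Tightness yields a weakly convergent subsequence, and the
  limit law has the desired characteristic function.
\<close>

lemma closed_gaussian_scales:
  assumes "prob_space M" and "Z \<in> borel_measurable M"
  shows "closed (gaussian_scales M Z)"
  unfolding closed_sequential_limits
proof (intro allI impI, elim conjE)
  let ?L = "distr M borel Z"
  have L: "real_distribution ?L" by (rule prob_space.real_distribution_distr[OF assms])
  fix s l assume s: "\<forall>n. s n \<in> gaussian_scales M Z" and lim: "s \<longlonglongrightarrow> l"
  then have nonneg: "0 \<le> s n" for n by (auto simp: gaussian_scales_def)
  with lim have "0 \<le> l" by (intro LIMSEQ_le_const) auto
  from s have "\<forall>n. \<exists>P. real_distribution P \<and>
      (\<forall>t. char P t = char ?L t * complex_of_real (exp (1 / 2 * (s n)\<^sup>2 * t\<^sup>2)))"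
    by (auto simp: gaussian_scales_def)
  then obtain P where P: "\<And>n. real_distribution (P n)"
    "\<And>n t. char (P n) t = char ?L t * complex_of_real (exp (1 / 2 * (s n)\<^sup>2 * t\<^sup>2))"
    by metis
  define Q where "Q n = normal_law 0 (s n)" for n
  have Q: "real_distribution (Q n)" for n
    unfolding Q_def using nonneg by (rule real_distribution_normal_law)
  have "tight P"
  proof (rule tight_if_add_median_zero_noise[OF P(1) Q])
    show "distr (P n \<Otimes>\<^sub>M Q n) borel (\<lambda>\<omega>. fst \<omega> + snd \<omega>) = ?L" for n
    proof (rule Levy_uniqueness[OF real_distribution_pair_measure_add[OF P(1) Q] L])
      show "char (distr (P n \<Otimes>\<^sub>M Q n) borel (\<lambda>\<omega>. fst \<omega> + snd \<omega>)) = char ?L"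
        unfolding fun_eq_iff char_pair_measure_add[OF P(1) Q]
        by (simp add: P(2) Q_def char_normal_law nonneg mult.assoc flip: of_real_mult exp_add)
    qed
  qed (simp_all only: Q_def normal_law_half_lines[OF nonneg])
  then obtain r R where r: "strict_mono r" "real_distribution R" "weak_conv_m (P \<circ> (\<lambda>n. n) \<circ> r) R"
    using tight_imp_convergent_subsubsequence[of P "\<lambda>n. n"] by (auto simp: strict_mono_def)
  have "char R t = char ?L t * complex_of_real (exp (1 / 2 * l\<^sup>2 * t\<^sup>2))" for t
  proof (rule LIMSEQ_unique)
    show "(\<lambda>n. char (P (r n)) t) \<longlonglongrightarrow> char R t"
      using levy_continuity1[OF _ r(2,3), of t] P(1) by (simp add: comp_def)
    have "(\<lambda>n. s (r n)) \<longlonglongrightarrow> l"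
      using LIMSEQ_subseq_LIMSEQ[OF lim r(1)] by (simp add: comp_def)
    then show "(\<lambda>n. char (P (r n)) t) \<longlonglongrightarrow> char ?L t * complex_of_real (exp (1 / 2 * l\<^sup>2 * t\<^sup>2))"
      unfolding P(2) by (intro tendsto_intros)
  qed
  with r(2) \<open>0 \<le> l\<close> show "l \<in> gaussian_scales M Z" by (auto simp: gaussian_scales_def)
qed

lemma gaussian_scales_attain_sup:
  assumes "prob_space M" and "Z \<in> borel_measurable M"
  obtains \<sigma> where "\<sigma> \<in> gaussian_scales M Z" "\<And>s. s \<in> gaussian_scales M Z \<Longrightarrow> s \<le> \<sigma>"
    "sigma_max M Z = ereal \<sigma>"
proof -
  let ?S = "gaussian_scales M Z"
  have mem: "Sup ?S \<in> ?S"
    using zero_in_gaussian_scales[OF assms]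
    by (intro closed_contains_Sup closed_gaussian_scales bdd_above_gaussian_scales assms) auto
  have upper: "s \<le> Sup ?S" if "s \<in> ?S" for s
    using that by (intro cSup_upper bdd_above_gaussian_scales assms)
  have "sigma_max M Z = ereal (Sup ?S)"
    unfolding sigma_max_def using mem upper by (intro Sup_eqI) auto
  with mem upper show ?thesis by (rule that)
qed

section \<open>The decomposition\<close>

theorem theorem6p7:
  fixes M :: "'a measure" and Z :: "'a \<Rightarrow> real"
  assumes "prob_space M" and "Z \<in> borel_measurable M"
  shows "\<exists>\<sigma>::real. 0 \<le> \<sigma> \<and> sigma_max M Z = ereal \<sigma> \<and>
    (\<exists>(N :: (real \<times> real) measure) Y G.
       prob_space N \<and>
       prob_space.indep_var N borel Y borel G \<and>
       gaussian_free N Y \<and>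
       distr N borel G = normal_law 0 \<sigma> \<and>
       distr M borel Z = distr N borel (\<lambda>\<omega>. Y \<omega> + G \<omega>) \<and>
       (\<forall>(N' :: 'b measure) Y' G' m \<tau>.
          prob_space N' \<longrightarrow>
          prob_space.indep_var N' borel Y' borel G' \<longrightarrow>
          gaussian_free N' Y' \<longrightarrow>
          0 \<le> \<tau> \<longrightarrow>
          distr N' borel G' = normal_law m \<tau> \<longrightarrow>
          distr M borel Z = distr N' borel (\<lambda>\<omega>. Y' \<omega> + G' \<omega>) \<longrightarrow>
          \<tau> = \<sigma> \<and> distr N' borel Y' = distr N borel (\<lambda>\<omega>. Y \<omega> - m)))"
proof -
  let ?L = "distr M borel Z"
  have L: "real_distribution ?L" by (rule prob_space.real_distribution_distr[OF assms])
  obtain \<sigma> where \<sigma>: "\<sigma> \<in> gaussian_scales M Z" "\<And>s. s \<in> gaussian_scales M Z \<Longrightarrow> s \<le> \<sigma>"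
    "sigma_max M Z = ereal \<sigma>"
    using gaussian_scales_attain_sup[OF assms] by metis
  then obtain P where "0 \<le> \<sigma>" and P: "real_distribution P"
    "\<And>t. char P t = char ?L t * complex_of_real (exp (1 / 2 * \<sigma>\<^sup>2 * t\<^sup>2))"
    by (auto simp: gaussian_scales_def)
  define N where "N = P \<Otimes>\<^sub>M normal_law 0 \<sigma>"
  have Q: "real_distribution (normal_law 0 \<sigma>)"
    using \<open>0 \<le> \<sigma>\<close> by (rule real_distribution_normal_law)
  note pair = indep_var_pair_measure[OF P(1) Q, folded N_def]
  interpret N: prob_space N by (rule pair)
  have fst_N[measurable]: "fst \<in> borel_measurable N"
    using pair(4) by (rule N.indep_var_rv1)
  have "gaussian_free N fst"
    unfolding gaussian_free_iff_scales[OF pair(1) fst_N]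
  proof (intro allI impI notI)
    fix s :: real assume "0 < s" "s \<in> gaussian_scales N fst"
    then obtain R where R: "real_distribution R"
      "\<And>t. char R t = char P t * complex_of_real (exp (1 / 2 * s\<^sup>2 * t\<^sup>2))"
      by (auto simp: gaussian_scales_def pair)
    \<comment> \<open>Variances of independent Gaussian factors add up.\<close>
    have "char R t = char ?L t * complex_of_real (exp (1 / 2 * (sqrt (\<sigma>\<^sup>2 + s\<^sup>2))\<^sup>2 * t\<^sup>2))" for t
      unfolding R(2) P(2) by (simp add: mult.assoc algebra_simps add_divide_distrib flip: of_real_mult exp_add)
    with R(1) have "sqrt (\<sigma>\<^sup>2 + s\<^sup>2) \<in> gaussian_scales M Z" by (auto simp: gaussian_scales_def)
    then have "sqrt (\<sigma>\<^sup>2 + s\<^sup>2) \<le> \<sigma>" by (rule \<sigma>)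
    then have "\<sigma>\<^sup>2 + s\<^sup>2 \<le> \<sigma>\<^sup>2" using \<open>0 \<le> \<sigma>\<close> real_sqrt_le_iff real_sqrt_unique by metis
    with \<open>0 < s\<close> show False by simp
  qed
  moreover have "?L = distr N borel (\<lambda>\<omega>. fst \<omega> + snd \<omega>)"
    unfolding N_def
  proof (rule Levy_uniqueness[OF L real_distribution_pair_measure_add[OF P(1) Q]])
    show "char ?L = char (distr (P \<Otimes>\<^sub>M normal_law 0 \<sigma>) borel (\<lambda>\<omega>. fst \<omega> + snd \<omega>))"
      unfolding fun_eq_iff char_pair_measure_add[OF P(1) Q]
      by (simp add: P(2) char_normal_law \<open>0 \<le> \<sigma>\<close> mult.assoc flip: of_real_mult exp_add)
  qed
  moreover have "\<tau> = \<sigma> \<and> distr N' borel Y' = distr N borel (\<lambda>\<omega>. fst \<omega> - m)"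
    if N': "prob_space N'" and indep: "prob_space.indep_var N' borel Y' borel G'"
      and free: "gaussian_free N' Y'" and "0 \<le> \<tau>"
      and G': "distr N' borel G' = normal_law m \<tau>"
      and Z: "?L = distr N' borel (\<lambda>\<omega>. Y' \<omega> + G' \<omega>)"
    for N' :: "'b measure" and Y' G' m \<tau>
  proof -
    interpret N': prob_space N' by fact
    have Y'_rv: "Y' \<in> borel_measurable N'" using indep by (rule N'.indep_var_rv1)
    let ?P' = "distr N' borel Y'"
    have P': "real_distribution ?P'" using Y'_rv by (rule N'.real_distribution_distr)
    have char_L: "char ?L t = char ?P' t * (iexp (t * m) * complex_of_real (exp (- (1 / 2 * \<tau>\<^sup>2 * t\<^sup>2))))" for t
      unfolding Z N'.char_distr_add[OF indep] G' char_normal_law[OF \<open>0 \<le> \<tau>\<close>] ..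
    \<comment> \<open>Absorbing the mean of \<open>G'\<close> into \<open>Y'\<close> exhibits \<open>\<tau>\<close> as a scale of \<open>Z\<close>.\<close>
    let ?P'm = "distr ?P' borel (\<lambda>x. m + 1 * x)"
    have "char ?P'm t = char ?L t * complex_of_real (exp (1 / 2 * \<tau>\<^sup>2 * t\<^sup>2))" for t
      unfolding char_distr_affine[OF P'] char_L
      by (simp add: mult.assoc flip: of_real_mult exp_add)
    then have "\<tau> \<in> gaussian_scales M Z"
      unfolding gaussian_scales_def using \<open>0 \<le> \<tau>\<close> P'
      by (auto intro!: exI[of _ ?P'm] real_distribution_distr_borel)
    then have "\<tau> \<le> \<sigma>" by (rule \<sigma>)
    \<comment> \<open>The law of \<open>Y - m\<close>, the candidate for the law of \<open>Y'\<close>.\<close>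
    let ?Pm = "distr P borel (\<lambda>x. - m + 1 * x)"
    have Pm: "real_distribution ?Pm"
      using P(1) by (rule real_distribution_distr_borel) simp
    have char_Pm: "char ?Pm t = char ?P' t * complex_of_real (exp (1 / 2 * (\<sigma>\<^sup>2 - \<tau>\<^sup>2) * t\<^sup>2))" for t
    proof -
      have "char ?Pm t = char ?P' t * (iexp (t * - m) * iexp (t * m)) *
          complex_of_real (exp (- (1 / 2 * \<tau>\<^sup>2 * t\<^sup>2)) * exp (1 / 2 * \<sigma>\<^sup>2 * t\<^sup>2))"
        unfolding char_distr_affine[OF P(1)] P(2) char_L by simp
      also have "iexp (t * - m) * iexp (t * m) = 1" by (simp flip: exp_add)
      also have "exp (- (1 / 2 * \<tau>\<^sup>2 * t\<^sup>2)) * exp (1 / 2 * \<sigma>\<^sup>2 * t\<^sup>2) = exp (1 / 2 * (\<sigma>\<^sup>2 - \<tau>\<^sup>2) * t\<^sup>2)"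
        by (simp add: algebra_simps diff_divide_distrib flip: exp_add)
      finally show ?thesis by simp
    qed
    have "sqrt (\<sigma>\<^sup>2 - \<tau>\<^sup>2) \<in> gaussian_scales N' Y'"
      unfolding gaussian_scales_def using \<open>0 \<le> \<tau>\<close> \<open>\<tau> \<le> \<sigma>\<close> Pm char_Pm
      by (auto intro!: exI[of _ ?Pm] simp: power_mono)
    then have "\<not> 0 < sqrt (\<sigma>\<^sup>2 - \<tau>\<^sup>2)"
      using free unfolding gaussian_free_iff_scales[OF N' Y'_rv] by blast
    then have "\<tau> = \<sigma>"
      using \<open>0 \<le> \<tau>\<close> \<open>\<tau> \<le> \<sigma>\<close> by (simp add: not_less power2_le_iff_abs_le)
    have "?P' = ?Pm"
      by (rule Levy_uniqueness[OF P' Pm]) (simp only: fun_eq_iff char_Pm, simp add: \<open>\<tau> = \<sigma>\<close>)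
    also have "\<dots> = distr (distr N borel fst) borel (\<lambda>x. - m + 1 * x)" by (simp only: pair)
    also have "\<dots> = distr N borel (\<lambda>\<omega>. fst \<omega> - m)"
      by (subst distr_distr) (auto simp: comp_def)
    finally show ?thesis using \<open>\<tau> = \<sigma>\<close> by simp
  qed
  ultimately show ?thesis
    using \<open>0 \<le> \<sigma>\<close> \<sigma>(3) pair by (intro exI[of _ \<sigma>] conjI exI[of _ N] exI[of _ fst] exI[of _ snd]) blast+
qed

end
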